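(* Let $\mathscr{R}$ be a bipotent, divisible, archimedean, complete semifield. Every principal corner locus of $\mathscr{R}^n$ (the set of corner roots of a supertropical polynomial) is a principal skeleton. In fact, there is a map $f\mapsto\widehat{f}$ sending a supertropical polynomial $f\in\mathcal{F}(\mathscr{R}[x_1,\dots,x_n])$ to a rational function $\widehat f\in\mathscr{R}(x_1,\dots,x_n)$ such that $x\in\mathscr{R}^n$ is a corner root of $f$ if and only if $\widehat f(x)=1$.
   Context: Semifields are commutative, have no zero element and are not fields. Bipotent: $a+b\in\{a,b\}$; order $a\le b\iff a+b=b$. The semifield $\mathscr{R}$ (bipotent, divisible, archimedean, conditionally complete as a lattice) is (isomorphic to) $(\mathbb{R}_{>0},\max,\cdot)$. $\mathscr{R}(x_1,\dots,x_n)$ is the semifield of fractions of $\mathscr{R}[x_1,\dots,x_n]$, its elements regarded as functions $\mathscr{R}^n\to\mathscr{R}$. A supertropical polynomial $f\in\mathcal{F}(\mathscr{R}[x_1,\dots,x_n])$ can be written uniquely as $f=\sum_{i}h_i+\sum_j g_j^{\nu}$ where the $h_i,g_j\in\mathscr{R}[x_1,\dots,x_n]$ are distinct monomials; the $h_i$ are its tangible monomials and the $g_j^\nu=g_j+g_j$ its ghost monomials. Equivalently, $f$ is a finite formal sum of monomials in which each tangible monomial occurs once and each ghost monomial occurs twice. $f$ is tangible if it has no ghost monomial. Evaluating on $\mathscr{R}^n$ (up to ghostness) means taking the maximum of the values of the component monomials. A point $a\in\mathscr{R}^n$ is a corner root of $f$ if either two distinct component monomials attain the maximal value $f(a)$ at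 $a$, or some ghost monomial of $f$ attains the maximal value at $a$. $Cor(f)$ is the set of corner roots of $f$ in $\mathscr{R}^n$; a principal corner locus is a set of the form $Cor(f)$. A principal skeleton is a set $Skel(f)=\{a\in\mathscr{R}^n: f(a)=1\}$ with $f\in\mathscr{R}(x_1,\dots,x_n)$. *)

theory Defs
  imports "HOL-Analysis.Finite_Cartesian_Product"
begin

section \<open>Semifields\<close>

text \<open>
  A semifield here is commutative, every element of it is invertible, and it has no zero element.
  The latter also rules out the one-element semifield, whose only element is neutral for addition;
  and a field is excluded since it has a zero.
\<close>

class semifield = comm_semiring + comm_monoid_mult + inverse +
  assumes semifield_left_inverse: "inverse a * a = 1"
    and semifield_divide_inverse: "a / b = a * inverse b"
    and semifield_no_zero: "\<not> (\<exists>z. \<forall>a. z + a = a)"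

class bipotent_semifield = semifield + linorder +
  assumes bipotent: "a + b = a \<or> a + b = b"
    and le_iff_plus: "a \<le> b \<longleftrightarrow> a + b = b"

text \<open>
  Completeness is conditional completeness of the order: nonempty bounded sets have suprema and
  infima. \<open>Sup\<close> and \<open>Inf\<close> are unconstrained on all other sets.
\<close>

class complete_bipotent_semifield = bipotent_semifield + conditionally_complete_linorder +
  assumes divisible: "0 < n \<Longrightarrow> \<exists>b. b ^ n = a"
    and archimedean: "1 < a \<Longrightarrow> \<exists>n. b \<le> a ^ n"


section \<open>Polynomials\<close>

text \<open>
  A formal polynomial with coefficients in \<open>'c\<close> in variables indexed by \<open>'n\<close>: a nonempty finite
  set of exponent vectors, each carrying one coefficient. As there is no zero coefficient, an
  exponent vector that does not occur is mapped to \<open>None\<close>, and there is no zero polynomial.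
\<close>

typedef ('c, 'n::finite) mpoly =
  "{p :: (nat, 'n) vec \<Rightarrow> 'c option. finite (dom p) \<and> dom p \<noteq> {}}"
  morphisms coeff_of Abs_mpoly
proof
  show "[0 \<mapsto> undefined] \<in> {p :: (nat, 'n) vec \<Rightarrow> 'c option. finite (dom p) \<and> dom p \<noteq> {}}"
    by simp
qed

definition support :: "('c, 'n::finite) mpoly \<Rightarrow> (nat, 'n) vec set" where
  "support p = dom (coeff_of p)"

definition monomial_value :: "'r::semifield \<Rightarrow> (nat, 'n::finite) vec \<Rightarrow> ('r, 'n) vec \<Rightarrow> 'r" where
  "monomial_value c e a = c * (\<Prod>i\<in>UNIV. (a $ i) ^ (e $ i))"

text \<open>Finite sums in a bipotent semifield are maxima, hence the use of \<open>Max\<close>.\<close>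

definition eval_poly :: "('r::bipotent_semifield, 'n::finite) mpoly \<Rightarrow> ('r, 'n) vec \<Rightarrow> 'r" where
  "eval_poly p a = Max ((\<lambda>e. monomial_value (the (coeff_of p e)) e a) ` support p)"

text \<open>Elements of the semifield of fractions of the polynomials, regarded as functions.\<close>

definition rational_functions :: "(('r::bipotent_semifield, 'n::finite) vec \<Rightarrow> 'r) set" where
  "rational_functions = {\<lambda>a. eval_poly p a / eval_poly q a | p q. True}"

definition Skel :: "(('r::bipotent_semifield, 'n::finite) vec \<Rightarrow> 'r) \<Rightarrow> ('r, 'n) vec set" where
  "Skel g = {a. g a = 1}"

definition principal_skeleton :: "('r::bipotent_semifield, 'n::finite) vec set \<Rightarrow> bool" where
  "principal_skeleton S \<longleftrightarrow> (\<exists>g\<in>rational_functions. S = Skel g)"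


section \<open>Supertropical polynomials\<close>

text \<open>
  A supertropical polynomial has coefficients that are tangible, \<open>c\<close>, or ghost, \<open>c + c\<close>.
  Monomials with the same exponent vector combine (into the larger one, or into a ghost if they
  are equal), so the unique decomposition into tangible and ghost monomials has one
  coefficient for each exponent vector.
\<close>

datatype 'r supertropical = Tangible (underlying: 'r) | Ghost (underlying: 'r)

definition component_value ::
  "('r::bipotent_semifield supertropical, 'n::finite) mpoly \<Rightarrow> (nat, 'n) vec \<Rightarrow> ('r, 'n) vec \<Rightarrow> 'r"
  where "component_value f e a = monomial_value (underlying (the (coeff_of f e))) e a"

text \<open>The value of a supertropical polynomial up to ghostness.\<close>

definition eval_super ::
  "('r::bipotent_semifield supertropical, 'n::finite) mpoly \<Rightarrow> ('r, 'n) vec \<Rightarrow> 'r"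
  where "eval_super f a = Max ((\<lambda>e. component_value f e a) ` support f)"

definition corner_root ::
  "('r::bipotent_semifield supertropical, 'n::finite) mpoly \<Rightarrow> ('r, 'n) vec \<Rightarrow> bool"
  where "corner_root f a \<longleftrightarrow>
    (\<exists>d\<in>support f. \<exists>e\<in>support f. d \<noteq> e \<and>
       component_value f d a = eval_super f a \<and> component_value f e a = eval_super f a) \<or>
    (\<exists>e c. coeff_of f e = Some (Ghost c) \<and> component_value f e a = eval_super f a)"

definition Cor ::
  "('r::bipotent_semifield supertropical, 'n::finite) mpoly \<Rightarrow> ('r, 'n) vec set"
  where "Cor f = {a. corner_root f a}"

definition principal_corner_locus :: "('r::bipotent_semifield, 'n::finite) vec set \<Rightarrow> bool" where
  "principal_corner_locus S \<longleftrightarrow> (\<exists>f. S = Cor f)"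

end

theory Submission
  imports Defs
begin

text \<open>
  Let \<open>m\<^sub>1 \<ge> m\<^sub>2 \<ge> \<dots>\<close> be the values at \<open>x\<close> of the monomials of \<open>f\<close>,
  every ghost monomial being listed twice. Then \<open>x\<close> is a corner root iff \<open>m\<^sub>2 = m\<^sub>1\<close>, that is, iff
  the second elementary symmetric polynomial of the monomials (with value \<open>m\<^sub>1 m\<^sub>2\<close>) agrees with
  \<open>f\<^sup>2\<close> (with value \<open>m\<^sub>1\<^sup>2\<close>). Hence \<open>hat f\<close> is the quotient of these two polynomials. If \<open>f\<close> is a
  single tangible monomial, then the former is an empty sum, there is no corner root, and any
  constant other than \<open>1\<close> will do.
\<close>

section \<open>Bipotent semifields\<close>

lemma semifield_mult_right_cancel:
  fixes a b c :: "'r::semifield"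
  shows "a * c = b * c \<longleftrightarrow> a = b"
proof
  assume "a * c = b * c"
  then have "a * (inverse c * c) = b * (inverse c * c)"
    by (simp add: mult.commute [of "inverse c"] flip: mult.assoc)
  then show "a = b"
    by (simp add: semifield_left_inverse)
qed simp

lemma semifield_divide_eq_1_iff:
  fixes a b :: "'r::semifield"
  shows "a / b = 1 \<longleftrightarrow> a = b"
proof -
  have "a / b = 1 \<longleftrightarrow> a * inverse b = b * inverse b"
    by (simp add: semifield_divide_inverse semifield_left_inverse mult.commute [of b "inverse b"])
  then show ?thesis
    by (simp add: semifield_mult_right_cancel)
qed

lemma bipotent_mult_right_mono:
  fixes a b c :: "'r::bipotent_semifield"
  assumes "a \<le> b"
  shows "a * c \<le> b * c"
  using assms by (simp add: le_iff_plus flip: distrib_right)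

lemma bipotent_mult_mono:
  fixes a b c d :: "'r::bipotent_semifield"
  assumes "a \<le> b" "c \<le> d"
  shows "a * c \<le> b * d"
proof -
  have "a * c \<le> b * c"
    using assms(1) by (rule bipotent_mult_right_mono)
  also have "\<dots> \<le> b * d"
    using bipotent_mult_right_mono [OF assms(2), of b] by (simp add: mult.commute)
  finally show ?thesis .
qed

text \<open>Monotonicity gives \<open>a * b \<le> m * b \<le> m * m\<close>. If the ends agree, both
  inequalities are equalities, and cancelling yields \<open>a = m\<close> and
  \<open>b = m\<close>.\<close>

lemma bipotent_mult_eq_square_iff:
  fixes a b m :: "'r::bipotent_semifield"
  assumes "a \<le> m" "b \<le> m"
  shows "a * b = m * m \<longleftrightarrow> a = m \<and> b = m"
proof
  assume eq: "a * b = m * m"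
  have "a * b \<le> m * b" "m * b \<le> m * m"
    using assms by (simp_all add: bipotent_mult_mono)
  then have "b * m = m * m" "a * b = m * b"
    using eq by (simp_all add: mult.commute [of b m])
  then show "a = m \<and> b = m"
    by (simp add: semifield_mult_right_cancel)
qed simp

text \<open>If 1 were the only element, it would be neutral for addition, against
  \<open>semifield_no_zero\<close>. The element obtained here serves as the constant for an
  \<open>f\<close> without corner pairs.\<close>

lemma ex_neq_1: "\<exists>c::'r::bipotent_semifield. c \<noteq> 1"
proof (rule ccontr)
  assume "\<not> ?thesis"
  then have all: "c = 1" for c :: 'r
    by simp
  have "1 + a = a" for a :: 'r
    by (rule trans [OF all all [symmetric]])
  then show False
    using semifield_no_zero by blast
qed


section \<open>Polynomials as finite sums of monomials\<close>

lemma monomial_value_mult: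
  "monomial_value (c * c') (e + e') a = monomial_value c e a * monomial_value c' e' a"
  by (simp add: monomial_value_def power_add prod.distrib mult_ac)

lemma monomial_value_0: "monomial_value c 0 a = c"
  by (simp add: monomial_value_def)

lemma finite_support: "finite (support p)"
  and support_nonempty: "support p \<noteq> {}"
  using coeff_of [of p] by (simp_all add: support_def)

text \<open>This replaces an arithmetic of \<open>mpoly\<close>: a finite sum of monomials may
  repeat an exponent vector, and keeping only the largest coefficient for each leaves the maximum
  unchanged, since multiplication is monotone.\<close>

lemma eval_poly_of_monomials:
  fixes T :: "('r::bipotent_semifield \<times> (nat, 'n::finite) vec) set"
  assumes "finite T" "T \<noteq> {}"
  obtains p where "\<And>a. eval_poly p a = Max ((\<lambda>(c, e). monomial_value c e a) ` T)"
proof -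
  \<comment> \<open>All coefficients that compete for the exponent vector \<open>e\<close>.\<close>
  define C where "C e = fst ` (T \<inter> (UNIV \<times> {e}))" for e
  define q where "q e = (if e \<in> snd ` T then Some (Max (C e)) else None)" for e
  have dom: "dom q = snd ` T"
    by (auto simp: q_def dom_def)
  then have coeff: "coeff_of (Abs_mpoly q) = q"
    using assms by (intro Abs_mpoly_inverse) auto
  have supp: "support (Abs_mpoly q) = snd ` T"
    by (simp add: support_def coeff dom)
  have finC: "finite (C e)" for e
    using assms(1) by (simp add: C_def)
  have C_iff: "c \<in> C e \<longleftrightarrow> (c, e) \<in> T" for c e
    by (force simp: C_def)
  have "eval_poly (Abs_mpoly q) a = Max ((\<lambda>(c, e). monomial_value c e a) ` T)" (is "?l = ?r") for a
  proof (rule order.antisym)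
    have "monomial_value (the (q e)) e a \<le> ?r" if e: "e \<in> snd ` T" for e
    proof -
      have "C e \<noteq> {}"
        using e C_iff by fastforce
      \<comment> \<open>A finite maximum is attained, so each monomial of \<open>q\<close> already
        occurs in \<open>T\<close>.\<close>
      then have "(Max (C e), e) \<in> T"
        using Max_in [OF finC] C_iff by blast
      then show ?thesis
        using assms(1) e by (intro Max_ge) (force simp: q_def)+
    qed
    then show "?l \<le> ?r"
      using assms by (auto simp: eval_poly_def supp coeff intro!: Max.boundedI)
    have "monomial_value c e a \<le> ?l" if ce: "(c, e) \<in> T" for c e
    proof -
      have e: "e \<in> snd ` T"
        using ce by force
      have "c \<le> Max (C e)"
        using ce finC C_iff by (intro Max_ge) auto
      then have "monomial_value c e a \<le> monomial_value (the (q e)) e a"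
        using e by (simp add: q_def monomial_value_def bipotent_mult_right_mono)
      also have "\<dots> \<le> ?l"
        using assms(1) e by (auto simp: eval_poly_def supp coeff intro!: Max_ge)
      finally show ?thesis .
    qed
    then show "?r \<le> ?l"
      using assms by (auto intro!: Max.boundedI)
  qed
  then show thesis
    by (rule that)
qed

lemma constant_in_rational_functions:
  "(\<lambda>_. c) \<in> (rational_functions :: (('r::bipotent_semifield, 'n::finite) vec \<Rightarrow> 'r) set)"
proof -
  obtain p :: "('r, 'n) mpoly" where p: "\<And>a. eval_poly p a = c"
    using eval_poly_of_monomials [of "{(c, 0)}"] by (auto simp: monomial_value_0)
  obtain q :: "('r, 'n) mpoly" where q: "\<And>a. eval_poly q a = 1"
    using eval_poly_of_monomials [of "{(1, 0)}"] by (auto simp: monomial_value_0)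
  have "c / 1 = c"
    using semifield_left_inverse [of "1::'r"] by (simp add: semifield_divide_inverse)
  then have "(\<lambda>_. c) = (\<lambda>a. eval_poly p a / eval_poly q a)"
    by (simp add: p q)
  then show ?thesis
    unfolding rational_functions_def by blast
qed


section \<open>Products of pairs of monomials\<close>

text \<open>Multiplying two monomials multiplies coefficients and adds exponents. Different pairs
  may give the same exponent \<open>d + e\<close>, which \<open>eval_poly_of_monomials\<close>
  permits. Numerator and denominator of the quotient both arise this way.\<close>

lemma eval_poly_of_component_pairs:
  fixes f :: "('r::bipotent_semifield supertropical, 'n::finite) mpoly"
  assumes "finite I" "I \<noteq> {}"
  obtains p where
    "\<And>a. eval_poly p a = Max ((\<lambda>(d, e). component_value f d a * component_value f e a) ` I)"
proof -
  let ?c = "\<lambda>e. underlying (the (coeff_of f e))"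
  obtain p where
    "\<And>a. eval_poly p a =
       Max ((\<lambda>(c, e). monomial_value c e a) ` (\<lambda>(d, e). (?c d * ?c e, d + e)) ` I)"
    using eval_poly_of_monomials [of "(\<lambda>(d, e). (?c d * ?c e, d + e)) ` I"] assms by auto
  then show thesis
    by (intro that [of p])
      (simp add: image_image case_prod_unfold monomial_value_mult component_value_def)
qed

text \<open>Index set of the second elementary symmetric polynomial. A diagonal pair stands for the
  two copies of a ghost monomial. Pairs are ordered, so other products occur twice, which does not
  affect a maximum.\<close>

definition corner_pairs ::
  "('r supertropical, 'n::finite) mpoly \<Rightarrow> ((nat, 'n) vec \<times> (nat, 'n) vec) set"
  where "corner_pairs f =
    {(d, e). d \<in> support f \<and> e \<in> support f \<and> (d = e \<longrightarrow> (\<exists>c. coeff_of f d = Some (Ghost c)))}"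

lemma corner_pairs_subset: "corner_pairs f \<subseteq> support f \<times> support f"
  by (auto simp: corner_pairs_def)

lemma corner_root_iff_corner_pairs:
  "corner_root f a \<longleftrightarrow>
    (\<exists>(d, e) \<in> corner_pairs f.
       component_value f d a = eval_super f a \<and> component_value f e a = eval_super f a)"
proof -
  have "coeff_of f e = Some (Ghost c) \<Longrightarrow> e \<in> support f" for e c
    by (auto simp: support_def)
  then show ?thesis
    unfolding corner_root_def corner_pairs_def by blast
qed

lemma component_value_le: "e \<in> support f \<Longrightarrow> component_value f e a \<le> eval_super f a"
  by (simp add: eval_super_def finite_support)

lemma eval_super_attained: "\<exists>e\<in>support f. component_value f e a = eval_super f a"
proof -
  have "eval_super f a \<in> (\<lambda>e. component_value f e a) ` support f"
    unfolding eval_super_def by (intro Max_in) (simp_all add: finite_support support_nonempty)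
  then show ?thesis
    by auto
qed

text \<open>Every product is bounded by the square of the maximal value, with equality only if both
  factors are maximal. So the maximum reaches this bound exactly when some pair in \<open>I\<close>
  does.\<close>

lemma Max_component_pairs_eq_square_iff:
  assumes "I \<subseteq> support f \<times> support f" "I \<noteq> {}"
  shows "Max ((\<lambda>(d, e). component_value f d a * component_value f e a) ` I) =
      eval_super f a * eval_super f a \<longleftrightarrow>
    (\<exists>(d, e)\<in>I. component_value f d a = eval_super f a \<and> component_value f e a = eval_super f a)"
proof -
  have fin: "finite I"
    using assms(1) finite_support finite_subset by blast
  have le: "component_value f d a * component_value f e a \<le> eval_super f a * eval_super f a"
    if "(d, e) \<in> I" for d e
    using that assms(1) by (auto intro!: bipotent_mult_mono component_value_le)
  have eq: "component_value f d a * component_value f e a = eval_super f a * eval_super f a \<longleftrightarrow>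
      component_value f d a = eval_super f a \<and> component_value f e a = eval_super f a"
    if "(d, e) \<in> I" for d e
    using that assms(1) by (intro bipotent_mult_eq_square_iff component_value_le) auto
  let ?m = "\<lambda>(d, e). component_value f d a * component_value f e a"
  have "Max (?m ` I) = eval_super f a * eval_super f a \<longleftrightarrow>
      eval_super f a * eval_super f a \<in> ?m ` I"
    using fin assms(2) le by (subst Max_eq_iff) auto
  also have "\<dots> \<longleftrightarrow> (\<exists>x\<in>I. ?m x = eval_super f a * eval_super f a)"
    unfolding image_iff by (intro bex_cong refl eq_commute)
  also have "\<dots> \<longleftrightarrow> (\<exists>(d, e)\<in>I. component_value f d a = eval_super f a \<and>
      component_value f e a = eval_super f a)"
    by (intro bex_cong refl) (auto simp: eq)
  finally show ?thesis .
qed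

lemma corner_root_rational_function:
  fixes f :: "('r::bipotent_semifield supertropical, 'n::finite) mpoly"
  shows "\<exists>g\<in>rational_functions. \<forall>x. corner_root f x \<longleftrightarrow> g x = 1"
proof (cases "corner_pairs f = {}")
  \<comment> \<open>Here \<open>f\<close> is a single tangible monomial: two exponents would give an
    off-diagonal pair, a ghost a diagonal one.\<close>
  case True
  then have "\<not> corner_root f x" for x
    by (simp add: corner_root_iff_corner_pairs)
  moreover obtain c :: 'r where "c \<noteq> 1"
    using ex_neq_1 by blast
  ultimately show ?thesis
    by (intro bexI [OF _ constant_in_rational_functions [of c]]) simp
next
  case False
  let ?S = "support f \<times> support f"
  let ?m = "\<lambda>a (d, e). component_value f d a * component_value f e a"
  have fin: "finite (corner_pairs f)"
    using corner_pairs_subset finite_support finite_subset by blast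
  obtain p where p: "\<And>a. eval_poly p a = Max (?m a ` corner_pairs f)"
    using eval_poly_of_component_pairs [OF fin False, of f] by auto
  obtain q where q: "\<And>a. eval_poly q a = Max (?m a ` ?S)"
    using eval_poly_of_component_pairs [of ?S f] by (auto simp: finite_support support_nonempty)
  \<comment> \<open>With all pairs allowed, the bound is always reached: pair a maximal monomial
    with itself.\<close>
  have "eval_poly q a = eval_super f a * eval_super f a" for a
    using eval_super_attained [of f a]
    by (subst q, subst Max_component_pairs_eq_square_iff) (auto simp: support_nonempty)
  then have "corner_root f a \<longleftrightarrow> eval_poly p a / eval_poly q a = 1" for a
    using Max_component_pairs_eq_square_iff [OF corner_pairs_subset False]
    by (simp add: semifield_divide_eq_1_iff corner_root_iff_corner_pairs p)
  moreover have "(\<lambda>a. eval_poly p a / eval_poly q a) \<in> rational_functions"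
    unfolding rational_functions_def by blast
  ultimately show ?thesis
    by (intro bexI [of _ "\<lambda>a. eval_poly p a / eval_poly q a"] allI)
qed

theorem proposition0p10p2p1:
  shows "(\<forall>S :: ('r::complete_bipotent_semifield, 'n::finite) vec set.
            principal_corner_locus S \<longrightarrow> principal_skeleton S) \<and>
         (\<exists>hat :: ('r supertropical, 'n) mpoly \<Rightarrow> (('r, 'n) vec \<Rightarrow> 'r).
            \<forall>f. hat f \<in> rational_functions \<and>
                (\<forall>x. corner_root f x \<longleftrightarrow> hat f x = 1))"
proof
  \<comment> \<open>A choice of one rational function for each \<open>f\<close> turns the existence
    statement into a map.\<close>
  obtain hat :: "('r supertropical, 'n) mpoly \<Rightarrow> (('r, 'n) vec \<Rightarrow> 'r)"
    where hat: "\<And>f. hat f \<in> rational_functions" "\<And>f x. corner_root f x \<longleftrightarrow> hat f x = 1"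
    using corner_root_rational_function by metis
  show "\<forall>S :: ('r, 'n) vec set. principal_corner_locus S \<longrightarrow> principal_skeleton S"
    using hat by (auto simp: principal_corner_locus_def principal_skeleton_def Cor_def Skel_def)
  show "\<exists>hat :: ('r supertropical, 'n) mpoly \<Rightarrow> (('r, 'n) vec \<Rightarrow> 'r).
            \<forall>f. hat f \<in> rational_functions \<and> (\<forall>x. corner_root f x \<longleftrightarrow> hat f x = 1)"
    using hat by blast
qed

end
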